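(* Let $H$ be a graph and let $\mathcal{F}(H)$ be the family of all graphs that do not contain $H$ as an induced subgraph. (i) Every graph in $\mathcal{F}(H)$ satisfies the Duplication-Rank Property if and only if $H$ is an induced subgraph of $P_4$. (ii) Every graph in $\mathcal{F}(H)$ satisfies the Coduplication-Rank Property if and only if $H$ is an induced subgraph of $P_4$.
   Context: All graphs are finite, simple and undirected; $A(G)$ denotes the $0/1$ adjacency matrix of $G$ and $I$ the identity matrix. $P_4$ is the path on 4 vertices. Two distinct vertices $u,v$ are duplicates if $N(u)=N(v)$ (equal open neighborhoods) and coduplicates if $N[u]=N[v]$ (equal closed neighborhoods, $N[v]=N(v)\cup\{v\}$). A graph $G$ has a duplication (resp. coduplication) if it has a pair of duplicate (resp. coduplicate) vertices. $G$ satisfies the Duplication-Rank Property if either $G$ has a duplication or $A(G)$ is nonsingular. $G$ satisfies the Coduplication-Rank Property if either $G$ has a coduplication or $A(G)+I$ is nonsingular.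
   Formalization: In (i), "every graph in F(H)" is restricted to graphs without isolated vertices, since the literal claim fails: the one-vertex graph is P_4-free, has no duplication, and its adjacency matrix is singular. In both parts the graphs in F(H) have natural numbers as vertices. *)

theory Defs
  imports "Graph_Theory.Graph_Theory" "Jordan_Normal_Form.Matrix"
begin

text \<open>
  A finite simple undirected graph is a \<^locale>\<open>pair_graph\<close>: a finite vertex set together with an
  irreflexive and symmetric set of pairs of vertices, so that the edge \<open>uv\<close> is represented by the
  two arcs \<open>(u, v)\<close> and \<open>(v, u)\<close>. The null graph is included.
\<close>

definition contains_induced :: "'b pair_pre_digraph \<Rightarrow> 'a pair_pre_digraph \<Rightarrow> bool" where
  "contains_induced G H \<longleftrightarrow>
     (\<exists>K :: 'b pair_pre_digraph.
        induced_subgraph (with_proj K) (with_proj G) \<and> digraph_iso (with_proj H) (with_proj K))"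

definition free_graphs :: "'a pair_pre_digraph \<Rightarrow> 'b pair_pre_digraph set" where
  "free_graphs H = {G. pair_graph G \<and> \<not> contains_induced G H}"

definition path4 :: "nat pair_pre_digraph" where
  "path4 = \<lparr> pverts = {0, 1, 2, 3},
             parcs = {(0, 1), (1, 0), (1, 2), (2, 1), (2, 3), (3, 2)} \<rparr>"

definition open_nbhd :: "'a pair_pre_digraph \<Rightarrow> 'a \<Rightarrow> 'a set" where
  "open_nbhd G v = {u. (v, u) \<in> parcs G}"

definition closed_nbhd :: "'a pair_pre_digraph \<Rightarrow> 'a \<Rightarrow> 'a set" where
  "closed_nbhd G v = open_nbhd G v \<union> {v}"

definition has_duplication :: "'a pair_pre_digraph \<Rightarrow> bool" where
  "has_duplication G \<longleftrightarrow>
     (\<exists>u \<in> pverts G. \<exists>v \<in> pverts G. u \<noteq> v \<and> open_nbhd G u = open_nbhd G v)"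

definition has_coduplication :: "'a pair_pre_digraph \<Rightarrow> bool" where
  "has_coduplication G \<longleftrightarrow>
     (\<exists>u \<in> pverts G. \<exists>v \<in> pverts G. u \<noteq> v \<and> closed_nbhd G u = closed_nbhd G v)"

text \<open>
  Rows and columns are indexed by the vertices in increasing order. Another enumeration would
  conjugate \<open>A\<close> by a permutation matrix, which does not affect the nonsingularity of \<open>A\<close> or \<open>A + I\<close>.
\<close>

definition adjacency_matrix :: "'a::linorder pair_pre_digraph \<Rightarrow> real mat" where
  "adjacency_matrix G =
     (let vs = sorted_list_of_set (pverts G); n = card (pverts G)
      in mat n n (\<lambda>(i, j). if (vs ! i, vs ! j) \<in> parcs G then 1 else 0))"

definition duplication_rank_property :: "'a::linorder pair_pre_digraph \<Rightarrow> bool" where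
  "duplication_rank_property G \<longleftrightarrow> has_duplication G \<or> invertible_mat (adjacency_matrix G)"

definition coduplication_rank_property :: "'a::linorder pair_pre_digraph \<Rightarrow> bool" where
  "coduplication_rank_property G \<longleftrightarrow>
     has_coduplication G \<or> invertible_mat (adjacency_matrix G + 1\<^sub>m (card (pverts G)))"

definition no_isolated_vertex :: "'a pair_pre_digraph \<Rightarrow> bool" where
  "no_isolated_vertex G \<longleftrightarrow> (\<forall>v \<in> pverts G. open_nbhd G v \<noteq> {})"

text \<open>
  An isolated vertex gives \<open>A\<close> a zero row, but a single isolated vertex need not have a duplicate.
  The graph with one vertex is therefore free of \<^const>\<open>path4\<close> and fails the
  Duplication-Rank Property, so the characterization for \<open>A\<close> is only
  true among graphs without isolated vertices. \<open>A + I\<close> needs no such restriction.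
\<close>

lemma contains_induced_path4_path4: "contains_induced path4 path4"
proof -
  let ?id = "\<lparr> iso_verts = id, iso_arcs = id, iso_head = snd, iso_tail = fst \<rparr>"
  have "wf_digraph (with_proj path4)"
    by unfold_locales (auto simp: path4_def)
  then have "induced_subgraph (with_proj path4) (with_proj path4)"
    and "pre_digraph.digraph_isomorphism (with_proj path4) ?id"
    by (auto intro: wf_digraph.induced_subgraph_refl simp: pre_digraph.digraph_isomorphism_def)
  moreover have "with_proj path4 = app_iso ?id (with_proj path4)"
    by (simp add: app_iso_def with_proj_def)
  ultimately show ?thesis
    unfolding contains_induced_def digraph_iso_def by blast
qed

lemma single_vertex_not_duplication_rank:
  fixes G :: "nat pair_pre_digraph"
  defines "G \<equiv> \<lparr> pverts = {0}, parcs = {} \<rparr>"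
  shows "G \<in> free_graphs path4" "\<not> duplication_rank_property G"
proof -
  have "pair_graph G"
    by unfold_locales (auto simp: G_def Digraph.symmetric_def sym_def)
  moreover have "\<not> contains_induced G path4"
  proof
    assume "contains_induced G path4"
    then obtain K :: "nat pair_pre_digraph" and h
      where sub: "parcs K \<subseteq> parcs G" and iso: "with_proj K = app_iso h (with_proj path4)"
      unfolding contains_induced_def digraph_iso_def induced_subgraph_def by auto
    have "parcs K = iso_arcs h ` parcs path4"
      using arg_cong[OF iso, of arcs] by (simp add: arcs_app_iso)
    then show False
      using sub by (auto simp: G_def path4_def)
  qed
  ultimately show "G \<in> free_graphs path4"
    by (simp add: free_graphs_def)
  have A: "adjacency_matrix G = 0\<^sub>m 1 1"
    by (rule eq_matI) (auto simp: adjacency_matrix_def G_def)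
  have "\<not> invertible_mat (0\<^sub>m 1 1 :: real mat)"
  proof
    assume "invertible_mat (0\<^sub>m 1 1 :: real mat)"
    then obtain B :: "real mat" where B: "0\<^sub>m 1 1 * B = 1\<^sub>m 1" "B * 0\<^sub>m 1 1 = 1\<^sub>m (dim_row B)"
      by (auto simp: invertible_mat_def inverts_mat_def)
    then have "dim_row B = 1" "dim_col B = 1"
      by (metis index_mult_mat(3) index_one_mat(3) index_zero_mat(3),
          metis index_mult_mat(3) index_one_mat(3))
    then have "(0\<^sub>m 1 1 * B) $$ (0, 0) = 0"
      by (simp add: scalar_prod_def)
    then show False
      using B(1) by simp
  qed
  then show "\<not> duplication_rank_property G"
    using A by (auto simp: duplication_rank_property_def has_duplication_def G_def)
qed

end

theory Submission
  imports Defs "Jordan_Normal_Form.Determinant"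
begin

text \<open>
  Suppose that \<open>(A + D) x = 0\<close> on a \<open>P\<^sub>4\<close>-free graph, where \<open>D\<close> is diagonal with entries in
  \<open>[0, 1]\<close>. A \<open>P\<^sub>4\<close>-free graph or its complement is disconnected, so it has twins as soon as it has
  two vertices. Two twins \<open>u, v\<close> can be merged into one vertex that carries \<open>x u + x v\<close> and has a new
  diagonal entry in \<open>[0, 1]\<close>. This preserves three conditions: no two duplicates both have
  entry 0, no two coduplicates both have entry 1, no isolated vertex has entry 0. Under them the
  last remaining vertex has a nonzero entry, hence \<open>x = 0\<close>. Taking \<open>D = 0\<close> and \<open>D = I\<close> gives the
  rank properties of \<open>P\<^sub>4\<close>-free graphs.

  Conversely, \<open>P\<^sub>5\<close> fails both properties. An induced subgraph of \<open>P\<^sub>5\<close> that does not embed into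
  \<open>P\<^sub>4\<close> contains \<open>3K\<^sub>1\<close> or \<open>2K\<^sub>2\<close>, and these are excluded by every graph on six vertices
  whose complement is a subgraph of the hexagon, as the hexagon has no triangle and no 4-cycle. The
  complements of \<open>C\<^sub>6\<close> and of \<open>P\<^sub>5 + K\<^sub>1\<close> are such graphs that fail the two properties.
\<close>

section \<open>Twins in graphs without an induced path on four vertices\<close>

text \<open>For symmetric irreflexive \<open>E\<close> the adjacency pattern itself forces
  \<open>a\<close>, \<open>b\<close>, \<open>c\<close>, \<open>d\<close> to be distinct.\<close>

definition P4_free :: "('a \<Rightarrow> 'a \<Rightarrow> bool) \<Rightarrow> 'a set \<Rightarrow> bool" where
  "P4_free E V \<longleftrightarrow> (\<forall>a\<in>V. \<forall>b\<in>V. \<forall>c\<in>V. \<forall>d\<in>V.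
     \<not> (E a b \<and> E b c \<and> E c d \<and> \<not> E a c \<and> \<not> E a d \<and> \<not> E b d))"

text \<open>A \<open>cut\<close> witnesses that a graph with symmetric \<open>E\<close> is
  disconnected; a cut of \<open>co E\<close> does so for the complement.\<close>

definition cut :: "('a \<Rightarrow> 'a \<Rightarrow> bool) \<Rightarrow> 'a set \<Rightarrow> 'a set \<Rightarrow> 'a set \<Rightarrow> bool" where
  "cut E V A B \<longleftrightarrow> A \<noteq> {} \<and> B \<noteq> {} \<and> A \<inter> B = {} \<and> A \<union> B = V \<and> (\<forall>a\<in>A. \<forall>b\<in>B. \<not> E a b)"

abbreviation co :: "('a \<Rightarrow> 'a \<Rightarrow> bool) \<Rightarrow> 'a \<Rightarrow> 'a \<Rightarrow> bool" where
  "co E \<equiv> \<lambda>x y. x \<noteq> y \<and> \<not> E x y"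

text \<open>Covers duplicates and coduplicates at once: the value of \<open>E u v\<close> tells
  which of the two occurs.\<close>

definition twins :: "('a \<Rightarrow> 'a \<Rightarrow> bool) \<Rightarrow> 'a set \<Rightarrow> 'a \<Rightarrow> 'a \<Rightarrow> bool" where
  "twins E V u v \<longleftrightarrow> u \<in> V \<and> v \<in> V \<and> u \<noteq> v \<and> (\<forall>w\<in>V - {u, v}. E u w \<longleftrightarrow> E v w)"

lemma P4_freeD:
  assumes "P4_free E V" "a \<in> V" "b \<in> V" "c \<in> V" "d \<in> V"
    and "E a b" "E b c" "E c d" "\<not> E a c" "\<not> E a d" "\<not> E b d"
  shows False
  using assms unfolding P4_free_def by blast

lemma P4_free_subset: "P4_free E V \<Longrightarrow> W \<subseteq> V \<Longrightarrow> P4_free E W"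
  unfolding P4_free_def by blast

text \<open>\<open>P_4\<close> is self-complementary: a path a-b-c-d in the complement is a path
  c-a-d-b in the graph.\<close>

lemma P4_free_co:
  assumes "symp E" "irreflp E" "P4_free E V"
  shows "P4_free (co E) V"
  unfolding P4_free_def
proof (intro ballI notI, elim conjE)
  fix a b c d assume V: "a \<in> V" "b \<in> V" "c \<in> V" "d \<in> V"
    and *: "a \<noteq> b" "\<not> E a b" "b \<noteq> c" "\<not> E b c" "c \<noteq> d" "\<not> E c d"
      "\<not> (a \<noteq> c \<and> \<not> E a c)" "\<not> (a \<noteq> d \<and> \<not> E a d)" "\<not> (b \<noteq> d \<and> \<not> E b d)"
  have "a \<noteq> c" "a \<noteq> d" "b \<noteq> d" using * assms(1) by (metis sympD)+
  with * have "E c a" "E a d" "E d b" using assms(1) by (metis sympD)+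
  moreover have "\<not> E c d" "\<not> E c b" "\<not> E a b" using * assms(1) by (metis sympD)+
  ultimately show False using assms(3) V unfolding P4_free_def by blast
qed

text \<open>If adding \<open>v\<close> destroys disconnectedness, then \<open>v\<close> must be
  adjacent to all of \<open>V\<close>, since a missed vertex would yield an induced path through
  \<open>v\<close>. Hence \<open>v\<close> is isolated in the complement.\<close>

lemma cut_cases_insert:
  assumes sym: "symp E" and P4: "P4_free E (insert v V)" and v: "v \<notin> V"
    and cut: "cut E V A B"
  shows "(\<exists>A B. cut E (insert v V) A B) \<or> (\<exists>A B. cut (co E) (insert v V) A B)"
proof (rule ccontr)
  assume "\<not> ?thesis"
  then have no: "\<And>A B. \<not> cut E (insert v V) A B" and noco: "\<And>A B. \<not> cut (co E) (insert v V) A B"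
    by auto
  \<comment> \<open>Stated for an arbitrary cut so that it applies to both sides of the given
    one.\<close>
  have no_miss: False if cut: "cut E V A B" and b: "b \<in> B" "\<not> E v b" for A B b
  proof -
    have AB: "A \<noteq> {}" "A \<inter> B = {}" "A \<union> B = V" "\<And>a b. a \<in> A \<Longrightarrow> b \<in> B \<Longrightarrow> \<not> E a b"
      using cut by (auto simp: cut_def)
    have "\<exists>a\<in>A. E v a"
    proof (rule ccontr)
      assume "\<not> ?thesis"
      then have "\<forall>a\<in>A. \<not> E a v" using sympD[OF sym] by blast
      then have "cut E (insert v V) A (insert v B)" using AB v by (auto simp: cut_def)
      then show False using no by blast
    qed
    then obtain a where a: "a \<in> A" "E v a" by blast
    define B0 where "B0 = {b \<in> B. \<not> E v b}"
    \<comment> \<open>Without such an edge, \<open>B0\<close> would be separated from everything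
      else. Its outer end \<open>c\<close> lies in \<open>B\<close> and is adjacent to
      \<open>v\<close>, so b0-c-v-a is an induced path.\<close>
    have "\<exists>b0\<in>B0. \<exists>c\<in>insert v V - B0. E b0 c"
    proof (rule ccontr)
      assume none: "\<not> ?thesis"
      have "b \<in> B0" "B0 \<subseteq> V" using b AB(3) by (auto simp: B0_def)
      with none v have "cut E (insert v V) B0 (insert v V - B0)" by (auto simp: cut_def)
      then show False using no by blast
    qed
    then obtain b0 c where c: "b0 \<in> B0" "c \<in> insert v V - B0" "E b0 c" by blast
    then have b0: "b0 \<in> B" "\<not> E v b0" "\<not> E b0 v" using sympD[OF sym] by (auto simp: B0_def)
    then have "c \<in> V" using c by auto
    have "c \<notin> A" using AB(4)[of c b0] b0 c sympD[OF sym] by blast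
    then have "c \<in> B" using AB(3) \<open>c \<in> V\<close> by blast
    then have "E c v" using c sympD[OF sym] by (auto simp: B0_def)
    moreover have "\<not> E c a" "\<not> E b0 a" using AB(4) a b0 \<open>c \<in> B\<close> sympD[OF sym] by blast+
    moreover have "a \<in> V" "b0 \<in> V" using a b0 AB(3) by blast+
    ultimately show False
      using P4_freeD[OF P4, of b0 c v a] a b0 c \<open>c \<in> V\<close> by blast
  qed
  have "cut E V B A" using cut unfolding cut_def by (metis Int_commute Un_commute sympD[OF sym])
  with no_miss cut have "\<forall>w\<in>V. E v w" unfolding cut_def by blast
  then have "cut (co E) (insert v V) {v} V"
    using cut v by (auto simp: cut_def)
  then show False using noco by blast
qed

text \<open>Seinsche's theorem, by adding one vertex at a time. As \<open>co (co E) = E\<close>, the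
  case of a disconnected complement is the other case applied to \<open>co E\<close>.\<close>

lemma P4_free_cut:
  assumes "finite V" "V \<noteq> {}" "\<nexists>v. V = {v}" "symp E" "irreflp E" "P4_free E V"
  shows "(\<exists>A B. cut E V A B) \<or> (\<exists>A B. cut (co E) V A B)"
  using assms
proof (induction V rule: finite_induct)
  case (insert v V)
  have sym: "symp (co E)" using insert.prems by (auto simp: symp_def)
  have coco: "co (co E) = E" using insert.prems by (auto simp: fun_eq_iff irreflp_def)
  show ?case
  proof (cases "\<exists>w. V = {w}")
    case True
    then obtain w where w: "V = {w}" by blast
    then have "cut E (insert v V) {v} {w} \<or> cut (co E) (insert v V) {v} {w}"
      using insert.hyps by (auto simp: cut_def)
    then show ?thesis by blast
  next
    case False
    have "V \<noteq> {}" using insert.prems by blast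
    with insert.IH False insert.prems P4_free_subset[of E "insert v V" V]
    have "(\<exists>A B. cut E V A B) \<or> (\<exists>A B. cut (co E) V A B)" by blast
    then show ?thesis
    proof (elim disjE exE)
      fix A B assume "cut E V A B"
      then show ?thesis using cut_cases_insert[of E v V A B] insert by blast
    next
      fix A B assume "cut (co E) V A B"
      then show ?thesis
        using cut_cases_insert[of "co E" v V A B, unfolded coco] insert.hyps sym
          P4_free_co[OF insert.prems(3-5)] by blast
    qed
  qed
qed simp

text \<open>Each side of a cut is a module: its vertices look alike from outside, so twins within a
  side are twins in \<open>V\<close>. If both sides are singletons, their two vertices are
  twins.\<close>

lemma twins_exist:
  assumes "finite V" "V \<noteq> {}" "\<nexists>v. V = {v}" "symp E" "irreflp E" "P4_free E V"
  shows "\<exists>u v. twins E V u v"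
  using assms
proof (induction V rule: finite_psubset_induct)
  case (psubset V)
  obtain A B where cut: "cut E V A B \<or> cut (co E) V A B"
    using P4_free_cut[OF psubset.hyps psubset.prems] by blast
  then have AB: "A \<noteq> {}" "B \<noteq> {}" "A \<inter> B = {}" "A \<union> B = V"
    by (auto simp: cut_def)
  have uni: "(\<forall>a\<in>A. \<forall>b\<in>B. \<not> E a b) \<or> (\<forall>a\<in>A. \<forall>b\<in>B. E a b)"
    using cut
  proof
    assume "cut E V A B"
    then show ?thesis by (simp add: cut_def)
  next
    assume "cut (co E) V A B"
    then have "\<not> co E a b" "a \<noteq> b" if "a \<in> A" "b \<in> B" for a b
      using that by (simp_all add: cut_def) blast
    then show ?thesis by blast
  qed
  have lift: "\<exists>u v. twins E V u v"
    if C: "C \<subset> V" "C \<noteq> {}" "\<nexists>v. C = {v}"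
      and uni: "\<And>u v w. u \<in> C \<Longrightarrow> v \<in> C \<Longrightarrow> w \<in> V - C \<Longrightarrow> E u w \<longleftrightarrow> E v w" for C
  proof -
    obtain u v where uv: "twins E C u v"
      using psubset.IH[OF C psubset.prems(3,4) P4_free_subset[OF psubset.prems(5)]] C(1) by blast
    have "E u w \<longleftrightarrow> E v w" if "w \<in> V - {u, v}" for w
      using uv that uni[of u v w]
      by (cases "w \<in> C") (auto simp: twins_def)
    then have "twins E V u v" using uv C(1) by (auto simp: twins_def)
    then show ?thesis by blast
  qed
  show ?case
  proof (cases "\<exists>a b. A = {a} \<and> B = {b}")
    case True
    then show ?thesis using AB unfolding twins_def by blast
  next
    case False
    have uniA: "E u w \<longleftrightarrow> E v w" if "u \<in> A" "v \<in> A" "w \<in> V - A" for u v w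
      using that AB(4) uni by blast
    have uniB: "E u w \<longleftrightarrow> E v w" if "u \<in> B" "v \<in> B" "w \<in> V - B" for u v w
    proof -
      have "w \<in> A" using that AB(4) by blast
      then have "E w u \<longleftrightarrow> E w v" using that uni by blast
      then show ?thesis using sympD[OF psubset.prems(3)] by blast
    qed
    have "A \<subset> V" "B \<subset> V" using AB by auto
    then have "\<exists>u v. twins E V u v" if "(\<nexists>a. A = {a}) \<or> (\<nexists>b. B = {b})"
      using that lift[of A, OF _ AB(1) _ uniA] lift[of B, OF _ AB(2) _ uniB] by blast
    then show ?thesis using False by blast
  qed
qed

section \<open>Merging twins in the kernel of a weighted adjacency matrix\<close>

text \<open>Nonadjacent twins with weights \<open>a\<close>, \<open>b\<close> share the value
  \<open>a * x = b * y\<close>. The merged weight must turn \<open>x + y\<close> into that value,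
  which for nonzero weights means that reciprocals add; this gives
  \<open>a * b / (a + b)\<close>.\<close>

lemma merge_weights:
  fixes a b x y :: real
  assumes "0 \<le> a" "a \<le> 1" "0 \<le> b" "b \<le> 1" "a \<noteq> 0 \<or> b \<noteq> 0" "a * x = b * y"
  obtains c where "0 \<le> c" "c < 1" "c * (x + y) = a * x" "c = 0 \<Longrightarrow> a = 0 \<or> b = 0"
    "x + y = 0 \<Longrightarrow> x = 0 \<and> y = 0"
proof
  let ?c = "a * b / (a + b)"
  have pos: "a + b > 0" using assms by linarith
  show "0 \<le> ?c" using assms by simp
  have "a * b \<le> a" using assms by (simp add: mult_left_le)
  moreover have "a * b \<le> b" using assms by (simp add: mult_left_le_one_le)
  ultimately have "a * b < a + b" using assms by linarith
  then show "?c < 1" using pos by simp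
  have sx: "(a + b) * x = b * (x + y)" using assms(6) by (simp add: algebra_simps)
  have "a * b * (x + y) = a * ((a + b) * x)" unfolding sx by simp
  then show "?c * (x + y) = a * x" using pos by (simp add: field_simps)
  show "?c = 0 \<Longrightarrow> a = 0 \<or> b = 0" using pos by simp
  show "x + y = 0 \<Longrightarrow> x = 0 \<and> y = 0" using sx pos by auto
qed

text \<open>
  Used with \<open>P = False\<close> for duplicates of weight 0 and with \<open>P = True\<close> for coduplicates of
  weight 1; \<open>Q\<close> and \<open>Q'\<close> say that a vertex has that weight before and after the merge.
\<close>

lemma merge_twins:
  assumes uv: "twins E V u v" and sym: "symp E"
    and ww: "twins E (V - {v}) w w'"
    and adj: "E w w' \<longleftrightarrow> P"
    and Q: "Q' u \<Longrightarrow> (E u v \<longleftrightarrow> P) \<and> (Q u \<or> Q v)"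
    and Q': "\<And>z. z \<noteq> u \<Longrightarrow> Q' z \<Longrightarrow> Q z"
    and red: "\<And>y z. twins E V y z \<Longrightarrow> (E y z \<longleftrightarrow> P) \<Longrightarrow> \<not> (Q y \<and> Q z)"
  shows "\<not> (Q' w \<and> Q' w')"
proof
  assume "Q' w \<and> Q' w'"
  have comm: "E x y \<longleftrightarrow> E y x" for x y using sym by (metis sympD)
  have twins_comm: "twins E W x y \<longleftrightarrow> twins E W y x" for W x y by (auto simp: twins_def)
  \<comment> \<open>Here \<open>u\<close>, \<open>v\<close>, \<open>z\<close> are pairwise twins of
    the same kind in \<open>V\<close>, so whichever of \<open>u\<close>, \<open>v\<close> satisfies
    \<open>Q\<close> clashes with \<open>z\<close>.\<close>
  have at_u: False if ww: "twins E (V - {v}) u z" and P: "E u z \<longleftrightarrow> P" and Qs: "Q' u" "Q' z" for z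
  proof -
    have z: "z \<noteq> u" "z \<noteq> v" "z \<in> V" and E: "E u v \<longleftrightarrow> P" using ww Q Qs by (auto simp: twins_def)
    have zv: "E z v \<longleftrightarrow> P" using uv ww P comm unfolding twins_def
      by (metis Diff_iff insert_iff empty_iff)
    have "twins E V u z" using ww uv zv E unfolding twins_def by blast
    moreover have "twins E V v z" using z ww uv zv E P comm unfolding twins_def
      by (metis Diff_iff insert_iff empty_iff)
    ultimately show False using red Q Q' Qs z P zv comm by metis
  qed
  consider "w = u" | "w' = u" | "w \<noteq> u" "w' \<noteq> u" by blast
  then show False
  proof cases
    case 1
    then show ?thesis using at_u ww adj \<open>Q' w \<and> Q' w'\<close> by blast
  next
    case 2
    then show ?thesis using at_u ww adj \<open>Q' w \<and> Q' w'\<close> twins_comm comm by blast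
  next
    case 3
    then have "twins E V w w'" using ww uv comm unfolding twins_def
      by (metis Diff_iff insert_iff empty_iff)
    then show False using red adj 3 Q' \<open>Q' w \<and> Q' w'\<close> by blast
  qed
qed

text \<open>Merging produces weights strictly between 0 and 1, so the induction needs a general
  diagonal \<open>d\<close>; both \<open>d\<close> and \<open>x\<close> vary along it.\<close>

lemma P4_free_kernel_trivial:
  fixes d x :: "'a \<Rightarrow> real"
  assumes "finite V" and sym: "symp E" and irr: "irreflp E" and "P4_free E V"
    and "\<And>v. v \<in> V \<Longrightarrow> 0 \<le> d v \<and> d v \<le> 1"
    and "\<And>u v. twins E V u v \<Longrightarrow> \<not> E u v \<Longrightarrow> \<not> (d u = 0 \<and> d v = 0)"
    and "\<And>u v. twins E V u v \<Longrightarrow> E u v \<Longrightarrow> \<not> (d u = 1 \<and> d v = 1)"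
    and "\<And>v. v \<in> V \<Longrightarrow> d v = 0 \<Longrightarrow> \<exists>w\<in>V. E v w"
    and "\<And>v. v \<in> V \<Longrightarrow> d v * x v + (\<Sum>w\<in>V. of_bool (E v w) * x w) = 0"
  shows "\<forall>v\<in>V. x v = 0"
  using assms(1,4-)
proof (induction V arbitrary: d x rule: finite_psubset_induct)
  case (psubset V)
  note P4 = psubset.prems(1) and d = psubset.prems(2) and dup = psubset.prems(3)
    and codup = psubset.prems(4) and iso = psubset.prems(5) and ker = psubset.prems(6)
  have noloop: "\<not> E y y" for y using irr by (simp add: irreflp_def)
  have comm: "E y z \<longleftrightarrow> E z y" for y z using sym by (metis sympD)
  consider "V = {}" | v where "V = {v}" | u v where "twins E V u v"
    using twins_exist[OF psubset.hyps _ _ sym irr P4] by blast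
  then show ?case
  proof cases
    case 1
    then show ?thesis by blast
  next
    case 2
    then have "d v \<noteq> 0" using iso noloop by auto
    then show ?thesis using ker[of v] 2 noloop by auto
  next
    case (3 u v)
    define p :: real where "p = of_bool (E u v)"
    have uv: "u \<in> V" "v \<in> V" "u \<noteq> v" using 3 by (auto simp: twins_def)
    have tw: "E y u \<longleftrightarrow> E y v" if "y \<in> V" "y \<noteq> u" "y \<noteq> v" for y
      using 3 that comm unfolding twins_def by blast
    have split: "(\<Sum>w\<in>V. f w) = f u + f v + (\<Sum>w\<in>V - {u, v}. f w)" for f :: "'a \<Rightarrow> real"
    proof -
      have "sum f V = sum f (insert u (insert v (V - {u, v})))"
        using uv by (intro arg_cong[of _ _ "sum f"]) auto
      also have "\<dots> = f u + f v + (\<Sum>w\<in>V - {u, v}. f w)"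
        using psubset.hyps uv by (simp add: add.assoc)
      finally show ?thesis .
    qed
    \<comment> \<open>The contribution of all other vertices, which is the same in the rows of
      \<open>u\<close> and \<open>v\<close>.\<close>
    define r where "r = (\<Sum>w\<in>V - {u, v}. of_bool (E u w) * x w)"
    have r': "r = (\<Sum>w\<in>V - {u, v}. of_bool (E v w) * x w)"
      unfolding r_def by (rule sum.cong) (use 3 in \<open>auto simp: twins_def\<close>)
    have eqs: "d u * x u + p * x v + r = 0" "d v * x v + p * x u + r = 0"
      using ker[OF uv(1)] ker[OF uv(2)] noloop comm[of v u]
      by (simp_all add: split r_def[symmetric] r'[symmetric] p_def)
    \<comment> \<open>The merged weight must satisfy the merged row and take an extreme value only
      if one of the twins had it and they are of the matching kind. The last conjunct allows
      \<open>x u\<close> and \<open>x v\<close> to be recovered.\<close>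
    have "\<exists>c. 0 \<le> c \<and> c \<le> 1 \<and> c * (x u + x v) + r = 0 \<and>
        (c = 0 \<longrightarrow> \<not> E u v \<and> (d u = 0 \<or> d v = 0)) \<and> (c = 1 \<longrightarrow> E u v \<and> (d u = 1 \<or> d v = 1)) \<and>
        (x u + x v = 0 \<longrightarrow> x u = 0 \<and> x v = 0)"
    proof (cases "E u v")
      case False
      then have "d u * x u = d v * x v" "d u \<noteq> 0 \<or> d v \<noteq> 0" using eqs dup[OF 3] by (auto simp: p_def)
      then obtain c where "0 \<le> c" "c < 1" "c * (x u + x v) = d u * x u" "c = 0 \<Longrightarrow> d u = 0 \<or> d v = 0"
        "x u + x v = 0 \<Longrightarrow> x u = 0 \<and> x v = 0"
        using merge_weights[of "d u" "d v" "x u" "x v"] d uv by blast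
      then show ?thesis using eqs False by (intro exI[of _ c]) (auto simp: p_def)
    next
      case True
      \<comment> \<open>Subtracting the rows of adjacent twins gives the nonadjacent situation for
        the weights \<open>1 - d u\<close> and \<open>1 - d v\<close>; hence \<open>1 - c\<close>
        below.\<close>
      have "(1 - d u) * x u = (1 - d v) * x v" "1 - d u \<noteq> 0 \<or> 1 - d v \<noteq> 0"
        using eqs codup[OF 3 True] True by (auto simp: p_def algebra_simps)
      then obtain c where "0 \<le> c" "c < 1" "c * (x u + x v) = (1 - d u) * x u"
        "c = 0 \<Longrightarrow> 1 - d u = 0 \<or> 1 - d v = 0" "x u + x v = 0 \<Longrightarrow> x u = 0 \<and> x v = 0"
        using merge_weights[of "1 - d u" "1 - d v" "x u" "x v"] d uv
        by (smt (verit, best))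
      then show ?thesis using eqs True by (intro exI[of _ "1 - c"]) (auto simp: p_def algebra_simps)
    qed
    then obtain c where c: "0 \<le> c" "c \<le> 1" "c * (x u + x v) + r = 0"
      and c0: "c = 0 \<Longrightarrow> \<not> E u v \<and> (d u = 0 \<or> d v = 0)"
      and c1: "c = 1 \<Longrightarrow> E u v \<and> (d u = 1 \<or> d v = 1)"
      and s0: "x u + x v = 0 \<Longrightarrow> x u = 0 \<and> x v = 0"
      by blast
    \<comment> \<open>The vertex \<open>u\<close> now stands for the merged pair, and
      \<open>v\<close> is deleted.\<close>
    define d' where "d' = d(u := c)"
    define x' where "x' = x(u := x u + x v)"
    have split': "(\<Sum>w\<in>V - {v}. f w) = f u + (\<Sum>w\<in>V - {u, v}. f w)" for f :: "'a \<Rightarrow> real"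
    proof -
      have "sum f (V - {v}) = sum f (insert u (V - {u, v}))"
        using uv by (intro arg_cong[of _ _ "sum f"]) auto
      then show ?thesis using psubset.hyps by simp
    qed
    have "\<forall>w\<in>V - {v}. x' w = 0"
    proof (rule psubset.IH)
      show "V - {v} \<subset> V" using uv by blast
      show "P4_free E (V - {v})" using P4 by (rule P4_free_subset) blast
      show "0 \<le> d' w \<and> d' w \<le> 1" if "w \<in> V - {v}" for w
        using that d c by (auto simp: d'_def)
      show "\<not> (d' w = 0 \<and> d' w' = 0)" if "twins E (V - {v}) w w'" "\<not> E w w'" for w w'
        by (rule merge_twins[OF 3 sym that(1), where P = False and Q = "\<lambda>z. d z = 0"])
          (use that c0 dup in \<open>auto simp: d'_def\<close>)
      show "\<not> (d' w = 1 \<and> d' w' = 1)" if "twins E (V - {v}) w w'" "E w w'" for w w'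
        by (rule merge_twins[OF 3 sym that(1), where P = True and Q = "\<lambda>z. d z = 1"])
          (use that c1 codup in \<open>auto simp: d'_def\<close>)
      show "\<exists>z\<in>V - {v}. E w z" if w: "w \<in> V - {v}" "d' w = 0" for w
      proof (cases "w = u")
        case True
        then have "\<not> E u v" "d u = 0 \<or> d v = 0" using c0 w by (auto simp: d'_def)
        \<comment> \<open>A twin of weight 0 has a neighbour; it is neither twin, so it is common to
          both.\<close>
        then obtain z where "z \<in> V" "E u z \<or> E v z" using iso uv by blast
        then show ?thesis using True \<open>\<not> E u v\<close> comm noloop tw by (metis Diff_iff singletonD)
      next
        case False
        then obtain z where "z \<in> V" "E w z" using iso w by (auto simp: d'_def)
        \<comment> \<open>If the neighbour is the deleted \<open>v\<close>, its twin
          \<open>u\<close> replaces it.\<close>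
        then show ?thesis using uv w False tw by (metis Diff_iff singletonD)
      qed
      show "d' w * x' w + (\<Sum>z\<in>V - {v}. of_bool (E w z) * x' z) = 0" if w: "w \<in> V - {v}" for w
      proof -
        have rest: "(\<Sum>z\<in>V - {u, v}. of_bool (E w z) * x' z) = (\<Sum>z\<in>V - {u, v}. of_bool (E w z) * x z)"
          by (rule sum.cong) (auto simp: x'_def)
        show ?thesis
        proof (cases "w = u")
          case True
          then show ?thesis using c noloop
            unfolding split' rest by (simp add: d'_def x'_def r_def)
        next
          case False
          then show ?thesis using ker[of w] w tw[of w]
            unfolding split' split rest by (simp add: d'_def x'_def algebra_simps)
        qed
      qed
    qed
    then have x': "\<And>w. w \<in> V \<Longrightarrow> w \<noteq> v \<Longrightarrow> x' w = 0" by blast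
    have "x u = 0 \<and> x v = 0" using x'[OF uv(1,3)] s0 by (simp add: x'_def)
    then show ?thesis using x' unfolding x'_def by (metis fun_upd_apply)
  qed
qed

section \<open>Kernels indexed by vertices\<close>

lemma invertible_mat_iff_kernel:
  fixes A :: "'a :: field mat"
  assumes A: "A \<in> carrier_mat n n"
  shows "invertible_mat A \<longleftrightarrow> (\<forall>v\<in>carrier_vec n. A *\<^sub>v v = 0\<^sub>v n \<longrightarrow> v = 0\<^sub>v n)"
proof
  assume "invertible_mat A"
  then obtain B where B: "A * B = 1\<^sub>m n" "B * A = 1\<^sub>m (dim_row B)"
    using A by (auto simp: invertible_mat_def inverts_mat_def)
  have "dim_row B = n" using arg_cong[OF B(2), of dim_col] A by simp
  moreover have "dim_col B = n" using arg_cong[OF B(1), of dim_col] by simp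
  ultimately have Bc: "B \<in> carrier_mat n n" by auto
  show "\<forall>v\<in>carrier_vec n. A *\<^sub>v v = 0\<^sub>v n \<longrightarrow> v = 0\<^sub>v n"
  proof (intro ballI impI)
    fix v :: "'a vec" assume v: "v \<in> carrier_vec n" and 0: "A *\<^sub>v v = 0\<^sub>v n"
    have "v = (B * A) *\<^sub>v v" using B(2) Bc v by simp
    also have "\<dots> = B *\<^sub>v 0\<^sub>v n" using assoc_mult_mat_vec[OF Bc A v] 0 by simp
    also have "\<dots> = 0\<^sub>v n" using Bc by (intro eq_vecI) auto
    finally show "v = 0\<^sub>v n" .
  qed
next
  assume "\<forall>v\<in>carrier_vec n. A *\<^sub>v v = 0\<^sub>v n \<longrightarrow> v = 0\<^sub>v n"
  then have "det A \<noteq> 0" using det_0_iff_vec_prod_zero[OF A] by blast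
  from det_non_zero_imp_unit[OF A this] obtain B
    where "B \<in> carrier_mat n n" "B * A = 1\<^sub>m n" "A * B = 1\<^sub>m n"
    unfolding Units_def by (auto simp: ring_mat_def)
  then show "invertible_mat A"
    using A by (auto simp: invertible_mat_def inverts_mat_def square_mat.simps)
qed

text \<open>Eliminates the vertex ordering: from here on, kernels are linear systems indexed by the
  vertices.\<close>

lemma invertible_mat_vertex_indexed:
  fixes f :: "'a :: linorder \<Rightarrow> 'a \<Rightarrow> real" and V :: "'a set"
  assumes "finite V"
  defines "vs \<equiv> sorted_list_of_set V"
  shows "invertible_mat (mat (card V) (card V) (\<lambda>(i, j). f (vs ! i) (vs ! j))) \<longleftrightarrow>
    (\<forall>x. (\<forall>v\<in>V. (\<Sum>w\<in>V. f v w * x w) = 0) \<longrightarrow> (\<forall>v\<in>V. x v = 0))"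
    (is "invertible_mat ?A \<longleftrightarrow> ?R")
proof -
  let ?n = "card V"
  have "distinct vs" "set vs = V" "length vs = ?n" using assms by simp_all
  then have bij: "bij_betw ((!) vs) {0..<?n} V"
    by (intro bij_betw_nth) auto
  have index: "\<exists>j<?n. v = vs ! j" if "v \<in> V" for v
    using that \<open>set vs = V\<close> \<open>length vs = ?n\<close> by (metis in_set_conv_nth)
  have in_V: "vs ! i \<in> V" if "i < ?n" for i
    using that \<open>set vs = V\<close> \<open>length vs = ?n\<close> by (metis nth_mem)
  have A: "?A \<in> carrier_mat ?n ?n" by simp
  have app: "(?A *\<^sub>v v) $ i = (\<Sum>w\<in>V. f (vs ! i) w * x w)"
    if "i < ?n" "v \<in> carrier_vec ?n" "\<And>j. j < ?n \<Longrightarrow> v $ j = x (vs ! j)" for v i x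
    unfolding sum.reindex_bij_betw[OF bij, symmetric] using that
    by (simp add: scalar_prod_def)
  show ?thesis
  proof
    assume inv: "invertible_mat ?A"
    show ?R
    proof (intro allI impI ballI)
      fix x v assume x: "\<forall>v\<in>V. (\<Sum>w\<in>V. f v w * x w) = 0" and v: "v \<in> V"
      let ?v = "vec ?n (\<lambda>j. x (vs ! j))"
      have "?A *\<^sub>v ?v = 0\<^sub>v ?n"
        using x in_V by (intro eq_vecI) (auto simp: app[where x = x] simp del: index_mult_mat_vec)
      then have "?v = 0\<^sub>v ?n" using inv invertible_mat_iff_kernel[OF A] by simp
      moreover obtain j where j: "j < ?n" "v = vs ! j" using index[OF v] by blast
      ultimately have "?v $ j = 0" by simp
      then show "x v = 0" using j by simp
    qed
  next
    assume R: ?R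
    show "invertible_mat ?A"
      unfolding invertible_mat_iff_kernel[OF A]
    proof (intro ballI impI)
      fix v :: "real vec" assume v: "v \<in> carrier_vec ?n" "?A *\<^sub>v v = 0\<^sub>v ?n"
      define x where "x w = v $ (inv_into {0..<?n} ((!) vs) w)" for w
      have x: "v $ j = x (vs ! j)" if "j < ?n" for j
        using that bij by (simp add: x_def bij_betw_def)
      have "\<forall>w\<in>V. (\<Sum>z\<in>V. f w z * x z) = 0"
      proof
        fix w assume "w \<in> V"
        then obtain i where i: "i < ?n" "w = vs ! i" using index by blast
        then show "(\<Sum>z\<in>V. f w z * x z) = 0" using app[OF i(1) v(1) x] v(2) by simp
      qed
      then have "\<forall>w\<in>V. x w = 0" using R by blast
      then show "v = 0\<^sub>v ?n" using v x in_V by (intro eq_vecI) auto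
    qed
  qed
qed

lemma invertible_adjacency_matrix:
  fixes G :: "'a :: linorder pair_pre_digraph"
  assumes "finite (pverts G)"
  shows "invertible_mat (adjacency_matrix G) \<longleftrightarrow>
    (\<forall>x :: 'a \<Rightarrow> real. (\<forall>v\<in>pverts G. (\<Sum>w\<in>pverts G. of_bool ((v, w) \<in> parcs G) * x w) = 0) \<longrightarrow> (\<forall>v\<in>pverts G. x v = 0))"
  using invertible_mat_vertex_indexed[OF assms, of "\<lambda>v w. of_bool ((v, w) \<in> parcs G)"]
  by (simp add: adjacency_matrix_def Let_def of_bool_def)

lemma invertible_adjacency_matrix_plus_one:
  fixes G :: "'a :: linorder pair_pre_digraph"
  assumes "finite (pverts G)"
  shows "invertible_mat (adjacency_matrix G + 1\<^sub>m (card (pverts G))) \<longleftrightarrow>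
    (\<forall>x :: 'a \<Rightarrow> real. (\<forall>v\<in>pverts G. x v + (\<Sum>w\<in>pverts G. of_bool ((v, w) \<in> parcs G) * x w) = 0) \<longrightarrow> (\<forall>v\<in>pverts G. x v = 0))"
proof -
  let ?V = "pverts G"
  let ?vs = "sorted_list_of_set ?V"
  let ?f = "\<lambda>v w. of_bool (v = w) + of_bool ((v, w) \<in> parcs G)"
  have "adjacency_matrix G + 1\<^sub>m (card ?V) = mat (card ?V) (card ?V) (\<lambda>(i, j). ?f (?vs ! i) (?vs ! j))"
    by (rule eq_matI) (auto simp: adjacency_matrix_def Let_def nth_eq_iff_index_eq assms)
  moreover have "(\<Sum>w\<in>?V. ?f v w * x w) = x v + (\<Sum>w\<in>?V. of_bool ((v, w) \<in> parcs G) * x w)"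
    if "v \<in> ?V" for x :: "'a \<Rightarrow> real" and v
  proof -
    have "(\<Sum>w\<in>?V. of_bool (v = w) * x w) = (\<Sum>w\<in>?V. if v = w then x w else 0)"
      by (rule sum.cong) auto
    also have "\<dots> = x v" using that assms by simp
    finally show ?thesis by (simp add: distrib_right sum.distrib)
  qed
  ultimately show ?thesis
    using invertible_mat_vertex_indexed[OF assms, of ?f] by simp
qed

section \<open>Induced embeddings\<close>

definition induced_embedding :: "('a \<Rightarrow> 'b) \<Rightarrow> 'a pair_pre_digraph \<Rightarrow> 'b pair_pre_digraph \<Rightarrow> bool" where
  "induced_embedding f H G \<longleftrightarrow> inj_on f (pverts H) \<and> f ` pverts H \<subseteq> pverts G \<and>
     (\<forall>u\<in>pverts H. \<forall>v\<in>pverts H. (f u, f v) \<in> parcs G \<longleftrightarrow> (u, v) \<in> parcs H)"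

text \<open>Arcs are pairs of vertices, so an isomorphism is determined by its vertex map.
  Conversely, the image of an embedding spans the required induced subgraph.\<close>

lemma contains_induced_iff:
  assumes G: "pair_wf_digraph G" and H: "pair_wf_digraph H"
  shows "contains_induced G H \<longleftrightarrow> (\<exists>f. induced_embedding f H G)"
proof
  interpret H: pair_wf_digraph H by (rule H)
  assume "contains_induced G H"
  then obtain K h where sub: "induced_subgraph (with_proj K) (with_proj G)"
    and h: "pre_digraph.digraph_isomorphism (with_proj H) h" and K: "with_proj K = app_iso h (with_proj H)"
    unfolding contains_induced_def digraph_iso_def by blast
  let ?f = "iso_verts h"
  have V: "pverts K = ?f ` pverts H" using arg_cong[OF K, of verts] by simp
  \<comment> \<open>With projections as tail and head, \<open>arcs_ends\<close> is the arc set
    itself, so the vertex map alone describes it.\<close>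
  have arcs: "parcs K = (\<lambda>(u, v). (?f u, ?f v)) ` parcs H"
    using arg_cong[OF K, of arcs_ends] H.arcs_ends_app_iso_eq[OF h] by simp
  have inj: "inj_on ?f (pverts H)" using H.digraph_isomorphism_inj_on_verts[OF h] by simp
  have KG: "pverts K \<subseteq> pverts G" "parcs K = {e \<in> parcs G. fst e \<in> pverts K \<and> snd e \<in> pverts K}"
    using sub by (auto simp: induced_subgraph_def subgraph_def)
  have "(?f u, ?f v) \<in> parcs G \<longleftrightarrow> (u, v) \<in> parcs H" if "u \<in> pverts H" "v \<in> pverts H" for u v
  proof -
    have "(?f u, ?f v) \<in> parcs G \<longleftrightarrow> (?f u, ?f v) \<in> parcs K" using that V KG by auto
    also have "\<dots> \<longleftrightarrow> (u, v) \<in> parcs H"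
      unfolding arcs using that H.in_arcsD1 H.in_arcsD2 by (auto dest!: inj_onD[OF inj])
    finally show ?thesis .
  qed
  then show "\<exists>f. induced_embedding f H G"
    using inj V KG unfolding induced_embedding_def by blast
next
  interpret G: pair_wf_digraph G by (rule G)
  interpret H: pair_wf_digraph H by (rule H)
  assume "\<exists>f. induced_embedding f H G"
  then obtain f where inj: "inj_on f (pverts H)" and im: "f ` pverts H \<subseteq> pverts G"
    and arcs: "\<And>u v. u \<in> pverts H \<Longrightarrow> v \<in> pverts H \<Longrightarrow> (f u, f v) \<in> parcs G \<longleftrightarrow> (u, v) \<in> parcs H"
    unfolding induced_embedding_def by blast
  define K where "K = \<lparr> pverts = f ` pverts H,
    parcs = {e \<in> parcs G. fst e \<in> f ` pverts H \<and> snd e \<in> f ` pverts H} \<rparr>"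
  have K: "wf_digraph (with_proj K)" by unfold_locales (auto simp: K_def)
  have "induced_subgraph (with_proj K) (with_proj G)"
    using K G.wf_digraph_axioms im
    by (auto simp: induced_subgraph_def subgraph_def compatible_def K_def)
  moreover have "digraph_iso (with_proj H) (with_proj K)"
    unfolding digraph_iso_def
  proof (intro exI conjI)
    let ?h = "\<lparr> iso_verts = f, iso_arcs = \<lambda>(u, v). (f u, f v), iso_head = snd, iso_tail = fst \<rparr>"
    have "inj_on (\<lambda>(u, v). (f u, f v)) (parcs H)"
      using inj H.in_arcsD1 H.in_arcsD2 by (auto simp: inj_on_def)
    then show "pre_digraph.digraph_isomorphism (with_proj H) ?h"
      using inj H.wf_digraph_axioms by (auto simp: pre_digraph.digraph_isomorphism_def)
    have "parcs K = (\<lambda>(u, v). (f u, f v)) ` parcs H"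
      using arcs H.in_arcsD1 H.in_arcsD2 by (fastforce simp: K_def)
    then show "with_proj K = app_iso ?h (with_proj H)"
      by (simp add: app_iso_def with_proj_def) (simp add: K_def)
  qed
  ultimately show "contains_induced G H" unfolding contains_induced_def by blast
qed

lemma induced_embedding_comp:
  assumes "induced_embedding f H G" "induced_embedding g G K"
  shows "induced_embedding (g \<circ> f) H K"
  using assms unfolding induced_embedding_def
  by (auto intro: comp_inj_on inj_on_subset simp: image_subset_iff)

definition graph_on :: "nat \<Rightarrow> (nat \<Rightarrow> nat \<Rightarrow> bool) \<Rightarrow> nat pair_pre_digraph" where
  "graph_on n E = \<lparr> pverts = {..<n}, parcs = {(u, v). u < n \<and> v < n \<and> E u v} \<rparr>"

lemma graph_on_simps [simp]:
  "pverts (graph_on n E) = {..<n}"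
  "(u, v) \<in> parcs (graph_on n E) \<longleftrightarrow> u < n \<and> v < n \<and> E u v"
  by (auto simp: graph_on_def)

lemma pair_graph_graph_on:
  assumes "symp E" "irreflp E"
  shows "pair_graph (graph_on n E)"
proof
  show "finite (parcs (graph_on n E))"
    by (rule finite_subset[of _ "{..<n} \<times> {..<n}"]) auto
  show "symmetric (with_proj (graph_on n E))"
    using assms by (auto simp: Digraph.symmetric_def intro!: symI dest: sympD)
qed (use assms in \<open>auto simp: irreflp_def\<close>)

text \<open>\<open>graph_on n consecutive\<close> is the path on \<open>n\<close> vertices.\<close>

definition consecutive :: "nat \<Rightarrow> nat \<Rightarrow> bool" where
  "consecutive u v \<longleftrightarrow> u = Suc v \<or> v = Suc u"

lemma path4_eq: "path4 = graph_on 4 consecutive"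
proof (rule pair_pre_digraph.equality)
  show "pverts path4 = pverts (graph_on 4 consecutive)"
    by (auto simp: path4_def)
  show "parcs path4 = parcs (graph_on 4 consecutive)"
    by (auto simp: path4_def graph_on_def consecutive_def)
qed simp

lemma pair_graph_imp_pair_wf_digraph: "pair_graph G \<Longrightarrow> pair_wf_digraph G"
  by (simp add: pair_graph_def pair_digraph_def pair_fin_digraph_def)

section \<open>Rank properties of graphs without an induced path on four vertices\<close>

lemma P4_free_if_no_path4:
  assumes G: "pair_graph G" and "\<not> contains_induced G path4"
  shows "P4_free (\<lambda>u v. (u, v) \<in> parcs G) (pverts G)"
  unfolding P4_free_def
proof (intro ballI notI, elim conjE)
  interpret G: pair_graph G by (rule G)
  fix a b c d assume V: "a \<in> pverts G" "b \<in> pverts G" "c \<in> pverts G" "d \<in> pverts G"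
    and E: "(a, b) \<in> parcs G" "(b, c) \<in> parcs G" "(c, d) \<in> parcs G"
    and N: "(a, c) \<notin> parcs G" "(a, d) \<notin> parcs G" "(b, d) \<notin> parcs G"
  have E': "(b, a) \<in> parcs G" "(c, b) \<in> parcs G" "(d, c) \<in> parcs G"
    using E G.arcs_symmetric by blast+
  have N': "(c, a) \<notin> parcs G" "(d, a) \<notin> parcs G" "(d, b) \<notin> parcs G"
    using N G.arcs_symmetric by blast+
  have loop: "(v, v) \<notin> parcs G" for v using G.no_loops' by blast
  have "distinct [a, b, c, d]" using E E' N N' loop by auto
  then have "induced_embedding (\<lambda>i. [a, b, c, d] ! i) path4 G"
    using V E E' N N' loop by (auto simp: induced_embedding_def path4_def numeral_eq_Suc)
  moreover have "pair_wf_digraph path4" by unfold_locales (auto simp: path4_def)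
  ultimately show False
    using assms(2) contains_induced_iff[OF G.pair_wf_digraph_axioms] by blast
qed

lemma rank_properties_if_no_path4:
  assumes G: "pair_graph G" and "\<not> contains_induced G path4"
  shows "no_isolated_vertex G \<Longrightarrow> duplication_rank_property G"
    and "coduplication_rank_property G"
proof -
  interpret G: pair_graph G by (rule G)
  let ?E = "\<lambda>u v. (u, v) \<in> parcs G" and ?V = "pverts G"
  have sym: "symp ?E" using G.arcs_symmetric by (auto simp: symp_def)
  have irr: "irreflp ?E" using G.no_loops' by (auto simp: irreflp_def)
  note P4 = P4_free_if_no_path4[OF assms]
  have nbhd: "open_nbhd G v \<subseteq> ?V" for v using G.in_arcsD2 by (auto simp: open_nbhd_def)
  have dup: "open_nbhd G u = open_nbhd G v" if "twins ?E ?V u v" "\<not> ?E u v" for u v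
    using that nbhd sympD[OF sym] irr
    by (fastforce simp: twins_def open_nbhd_def irreflp_def)
  have codup: "closed_nbhd G u = closed_nbhd G v" if "twins ?E ?V u v" "?E u v" for u v
    using that nbhd sympD[OF sym] irr
    by (fastforce simp: twins_def closed_nbhd_def open_nbhd_def irreflp_def)
  show "duplication_rank_property G" if iso: "no_isolated_vertex G"
    unfolding duplication_rank_property_def
  proof (rule disjCI)
    assume "\<not> invertible_mat (adjacency_matrix G)"
    then obtain x :: "'a \<Rightarrow> real"
      where x: "\<forall>v\<in>?V. (\<Sum>w\<in>?V. of_bool (?E v w) * x w) = 0" "\<not> (\<forall>v\<in>?V. x v = 0)"
      unfolding invertible_adjacency_matrix[OF G.pair_finite_verts] by blast
    show "has_duplication G"
    proof (rule ccontr)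
      assume no: "\<not> has_duplication G"
      \<comment> \<open>With all weights 0, the condition on coduplicates is vacuous, and the one on
        isolated vertices is \<open>iso\<close>.\<close>
      have "\<forall>v\<in>?V. x v = 0"
      proof (rule P4_free_kernel_trivial[OF G.pair_finite_verts sym irr P4, where d = "\<lambda>_. 0"])
        show "\<not> (0 = (0::real) \<and> 0 = (0::real))" if "twins ?E ?V u v" "\<not> ?E u v" for u v
          using no dup[OF that] that(1) by (auto simp: has_duplication_def twins_def)
        show "\<exists>w\<in>?V. ?E v w" if "v \<in> ?V" for v
          using iso that nbhd by (fastforce simp: no_isolated_vertex_def open_nbhd_def)
      qed (use x in auto)
      then show False using x by blast
    qed
  qed
  show "coduplication_rank_property G"
    unfolding coduplication_rank_property_def
  proof (rule disjCI)
    assume "\<not> invertible_mat (adjacency_matrix G + 1\<^sub>m (card ?V))"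
    then obtain x :: "'a \<Rightarrow> real"
      where x: "\<forall>v\<in>?V. x v + (\<Sum>w\<in>?V. of_bool (?E v w) * x w) = 0" "\<not> (\<forall>v\<in>?V. x v = 0)"
      unfolding invertible_adjacency_matrix_plus_one[OF G.pair_finite_verts] by blast
    show "has_coduplication G"
    proof (rule ccontr)
      assume no: "\<not> has_coduplication G"
      \<comment> \<open>With all weights 1, the conditions on weight 0 are vacuous, so isolated
        vertices are harmless.\<close>
      have "\<forall>v\<in>?V. x v = 0"
      proof (rule P4_free_kernel_trivial[OF G.pair_finite_verts sym irr P4, where d = "\<lambda>_. 1"])
        show "\<not> (1 = (1::real) \<and> 1 = (1::real))" if "twins ?E ?V u v" "?E u v" for u v
          using no codup[OF that] that(1) by (auto simp: has_coduplication_def twins_def)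
      qed (use x in auto)
      then show False using x by blast
    qed
  qed
qed

section \<open>Certificates for the failure of a rank property\<close>

text \<open>Reduces failure to a finite check: a distinguishing vertex for every pair and a nonzero
  kernel vector \<open>x\<close>.\<close>

lemma graph_on_not_duplication_rank:
  fixes x :: "nat \<Rightarrow> real"
  assumes "\<forall>u<n. \<forall>v<n. u \<noteq> v \<longrightarrow> (\<exists>w<n. E u w \<noteq> E v w)"
    and "\<forall>v<n. (\<Sum>w<n. of_bool (E v w) * x w) = 0" and "\<exists>v<n. x v \<noteq> 0"
  shows "\<not> duplication_rank_property (graph_on n E)"
proof -
  have "\<not> has_duplication (graph_on n E)"
    using assms(1) by (auto simp: has_duplication_def open_nbhd_def set_eq_iff)
  moreover have "(\<Sum>w<n. of_bool (v < n \<and> w < n \<and> E v w) * x w) = (\<Sum>w<n. of_bool (E v w) * x w)"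
    if "v < n" for v
    using that by (intro sum.cong) auto
  ultimately show ?thesis
    using assms(2,3) invertible_adjacency_matrix[of "graph_on n E"]
    by (auto simp: duplication_rank_property_def)
qed

lemma graph_on_not_coduplication_rank:
  fixes x :: "nat \<Rightarrow> real"
  assumes "\<forall>u<n. \<forall>v<n. u \<noteq> v \<longrightarrow> (\<exists>w<n. (u = w \<or> E u w) \<noteq> (v = w \<or> E v w))"
    and "\<forall>v<n. x v + (\<Sum>w<n. of_bool (E v w) * x w) = 0" and "\<exists>v<n. x v \<noteq> 0"
  shows "\<not> coduplication_rank_property (graph_on n E)"
proof -
  have nbhd: "w \<in> closed_nbhd (graph_on n E) u \<longleftrightarrow> u = w \<or> E u w" if "u < n" "w < n" for u w
    using that by (auto simp: closed_nbhd_def open_nbhd_def)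
  have "closed_nbhd (graph_on n E) u \<noteq> closed_nbhd (graph_on n E) v" if "u < n" "v < n" "u \<noteq> v" for u v
    using assms(1) that nbhd by metis
  then have "\<not> has_coduplication (graph_on n E)"
    by (auto simp: has_coduplication_def)
  moreover have "(\<Sum>w<n. of_bool (v < n \<and> w < n \<and> E v w) * x w) = (\<Sum>w<n. of_bool (E v w) * x w)"
    if "v < n" for v
    using that by (intro sum.cong) auto
  ultimately show ?thesis
    using assms(2,3) invertible_adjacency_matrix_plus_one[of "graph_on n E"]
    by (auto simp: coduplication_rank_property_def)
qed

section \<open>Reduced singular graphs\<close>

definition hexagon :: "nat \<Rightarrow> nat \<Rightarrow> bool" where
  "hexagon u v \<longleftrightarrow> consecutive u v \<or> u = 0 \<and> v = 5 \<or> u = 5 \<and> v = 0"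

text \<open>On six vertices, the path 0-1-2-3-4 with 5 isolated; a subgraph of the hexagon.\<close>

definition path5_plus_vertex :: "nat \<Rightarrow> nat \<Rightarrow> bool" where
  "path5_plus_vertex u v \<longleftrightarrow> consecutive u v \<and> u \<noteq> 5 \<and> v \<noteq> 5"

lemmas finite_check = numeral_eq_Suc All_less_Suc Ex_less_Suc lessThan_Suc consecutive_def
  hexagon_def path5_plus_vertex_def

lemma hexagonD:
  assumes "hexagon x y" "x < 6" "y < 6"
  shows "y = (if x = 5 then 0 else Suc x) \<or> y = (if x = 0 then 5 else x - 1)"
  using assms by (auto simp: hexagon_def consecutive_def)

lemma hexagon_triangle_free:
  assumes "x < 6" "y < 6" "z < 6" "hexagon x y" "hexagon y z" "hexagon x z"
  shows False
proof -
  have "x = 0 \<or> x = 1 \<or> x = 2 \<or> x = 3 \<or> x = 4 \<or> x = 5" using assms(1) by arith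
  then show False using assms by (elim disjE) (auto simp: hexagon_def consecutive_def)
qed

text \<open>Neighbours are the successor and the predecessor modulo 6. Two vertices with the same
  pair of neighbours would coincide, or be 2 apart in both directions, which needs 4 to be 0 modulo
  6.\<close>

lemma hexagon_C4_free:
  assumes "x < 6" "y < 6" "z < 6" "w < 6" "x \<noteq> y" "z \<noteq> w"
    and "hexagon x z" "hexagon x w" "hexagon y z" "hexagon y w"
  shows False
proof -
  define s p :: "nat \<Rightarrow> nat"
    where "s x = (if x = 5 then 0 else Suc x)" and "p x = (if x = 0 then 5 else x - 1)" for x
  have D: "y = s x \<or> y = p x" if "hexagon x y" "x < 6" "y < 6" for x y
    using hexagonD[OF that] by (simp only: s_def p_def)
  have "s x \<noteq> s y" "p x \<noteq> p y" "\<not> (s x = p y \<and> p x = s y)"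
    using assms(1,2,5) by (auto simp: s_def p_def split: if_splits)
  moreover have "z = s x \<and> w = p x \<or> z = p x \<and> w = s x"
    using D[of x z] D[of x w] assms by blast
  moreover have "z = s y \<and> w = p y \<or> z = p y \<and> w = s y"
    using D[of y z] D[of y w] assms by blast
  ultimately show False by (elim disjE conjE) simp_all
qed

lemma consecutive_sym: "symp consecutive" and consecutive_irrefl: "irreflp consecutive"
  by (auto simp: symp_def irreflp_def consecutive_def)

lemma path5_not_duplication_rank: "\<not> duplication_rank_property (graph_on 5 consecutive)"
  by (rule graph_on_not_duplication_rank[where x = "\<lambda>i. [1, 0, -1, 0, 1] ! i"])
    (simp_all add: finite_check)

lemma path5_not_coduplication_rank: "\<not> coduplication_rank_property (graph_on 5 consecutive)"
  by (rule graph_on_not_coduplication_rank[where x = "\<lambda>i. [1, -1, 0, 1, -1] ! i"])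
    (simp_all add: finite_check)

text \<open>The matrix is the all-ones matrix minus \<open>A + I\<close> of the hexagon. The vector
  has sum 0, and any three cyclically consecutive entries sum to 0.\<close>

lemma co_hexagon_not_duplication_rank: "\<not> duplication_rank_property (graph_on 6 (co hexagon))"
  by (rule graph_on_not_duplication_rank[where x = "\<lambda>i. [1, -1, 0, 1, -1, 0] ! i"])
    (simp_all add: finite_check)

text \<open>Here \<open>A + I\<close> is the all-ones matrix minus the adjacency matrix of
  \<open>P_5 + K_1\<close>. The kernel vector of \<open>P_5\<close> has sum 1, which the entry -1 at
  the isolated vertex balances.\<close>

lemma co_path5_plus_vertex_not_coduplication_rank:
  "\<not> coduplication_rank_property (graph_on 6 (co path5_plus_vertex))"
  by (rule graph_on_not_coduplication_rank[where x = "\<lambda>i. [1, 0, -1, 0, 1, -1] ! i"])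
    (simp_all add: finite_check)

lemma path5_no_isolated_vertex: "no_isolated_vertex (graph_on 5 consecutive)"
proof -
  have "\<forall>v<5. \<exists>w<5. consecutive v w" by (simp add: finite_check)
  then show ?thesis by (auto simp: no_isolated_vertex_def open_nbhd_def)
qed

lemma co_hexagon_no_isolated_vertex: "no_isolated_vertex (graph_on 6 (co hexagon))"
proof -
  have "\<forall>v<6. \<exists>w<6. co hexagon v w" by (simp add: finite_check)
  then show ?thesis by (auto simp: no_isolated_vertex_def open_nbhd_def)
qed

section \<open>Graphs embedding into both counterexamples\<close>

text \<open>Vertices of \<open>H\<close> at distinct nonadjacent positions of the path are sent by
  \<open>g\<close> to hexagon edges, which limits the positions \<open>S\<close> that
  \<open>H\<close> can occupy.\<close>

lemma embeds_in_path4: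
  assumes f: "induced_embedding f H (graph_on 5 consecutive)"
    and g: "induced_embedding g H (graph_on 6 E)"
    and E: "\<And>u v. u \<noteq> v \<Longrightarrow> \<not> E u v \<Longrightarrow> hexagon u v"
  shows "\<exists>h. induced_embedding h H path4"
proof -
  define S where "S = f ` pverts H"
  have "{..<5} = {0, 1, 2, 3, 4 :: nat}" by auto
  then have S: "S \<subseteq> {0, 1, 2, 3, 4}" using f by (simp add: S_def induced_embedding_def)
  have g6: "g p < 6" if "p \<in> pverts H" for p
    using g that by (auto simp: induced_embedding_def)
  have g_inj: "g p \<noteq> g q" if "p \<in> pverts H" "q \<in> pverts H" "f p \<noteq> f q" for p q
    using g that by (auto simp: induced_embedding_def dest: inj_onD)
  have g_hex: "hexagon (g p) (g q)"
    if "p \<in> pverts H" "q \<in> pverts H" "f p \<noteq> f q" "\<not> consecutive (f p) (f q)" for p q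
  proof (rule E)
    show "g p \<noteq> g q" using g_inj that by blast
    have "(p, q) \<notin> parcs H" using f that by (auto simp: induced_embedding_def)
    then show "\<not> E (g p) (g q)" using g that g6 by (auto simp: induced_embedding_def)
  qed
  have "\<not> {0, 2, 4} \<subseteq> S"
  proof
    assume "{0, 2, 4} \<subseteq> S"
    then obtain p q r where pqr: "p \<in> pverts H" "q \<in> pverts H" "r \<in> pverts H" "f p = 0" "f q = 2" "f r = 4"
      unfolding S_def by (auto 0 4)
    then show False
      using hexagon_triangle_free[of "g p" "g q" "g r"] g6 g_hex by (simp add: consecutive_def)
  qed
  \<comment> \<open>The four nonadjacent pairs between {0, 1} and {3, 4} would form a 4-cycle in the
    hexagon.\<close>
  moreover have "\<not> {0, 1, 3, 4} \<subseteq> S"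
  proof
    assume "{0, 1, 3, 4} \<subseteq> S"
    then obtain p q r s where "p \<in> pverts H" "q \<in> pverts H" "r \<in> pverts H" "s \<in> pverts H"
      "f p = 0" "f q = 1" "f r = 3" "f s = 4"
      unfolding S_def by (auto 0 4)
    then show False
      using hexagon_C4_free[of "g p" "g q" "g r" "g s"] g6 g_hex g_inj by (simp add: consecutive_def)
  qed
  \<comment> \<open>Either an end of the path is missing, or the middle 2 is missing together with 1
    or 3.\<close>
  ultimately have "S \<subseteq> {0, 1, 2, 3} \<or> S \<subseteq> {1, 2, 3, 4} \<or> S \<subseteq> {0, 3, 4} \<or> S \<subseteq> {0, 1, 4}"
    using S by blast
  then obtain T where ST: "S \<subseteq> T"
    and T: "T \<in> {{0, 1, 2, 3}, {1, 2, 3, 4}, {0, 3, 4}, {0, 1, 4}}"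
    by blast
  \<comment> \<open>The map \<open>r\<close> shifts the path, or closes the gap of two missing
    vertices to one.\<close>
  have "\<exists>r. inj_on r T \<and> r ` T \<subseteq> {..<4} \<and> (\<forall>a\<in>T. \<forall>b\<in>T. consecutive (r a) (r b) \<longleftrightarrow> consecutive a b)"
    using T
  proof (elim insertE emptyE)
    assume "T = {0, 1, 2, 3}"
    then show ?thesis by (intro exI[of _ id]) auto
  next
    assume "T = {1, 2, 3, 4}"
    then show ?thesis by (intro exI[of _ "\<lambda>i. i - 1"]) (auto simp: consecutive_def)
  next
    assume "T = {0, 3, 4}"
    then show ?thesis by (intro exI[of _ "\<lambda>i. i - of_bool (i \<noteq> 0)"]) (auto simp: consecutive_def)
  next
    assume "T = {0, 1, 4}"
    then show ?thesis by (intro exI[of _ "\<lambda>i. i - of_bool (i = 4)"]) (auto simp: consecutive_def)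
  qed
  then obtain r where r: "inj_on r T" "r ` T \<subseteq> {..<4}"
    "\<And>a b. a \<in> T \<Longrightarrow> b \<in> T \<Longrightarrow> consecutive (r a) (r b) \<longleftrightarrow> consecutive a b"
    by blast
  have fT: "f p \<in> T" if "p \<in> pverts H" for p using that ST by (auto simp: S_def)
  have f5: "f p < 5" if "p \<in> pverts H" for p using f that by (auto simp: induced_embedding_def)
  have r4: "r (f p) < 4" if "p \<in> pverts H" for p using r(2) fT[OF that] by blast
  have "induced_embedding (r \<circ> f) H path4"
    unfolding induced_embedding_def path4_eq
  proof (intro conjI ballI)
    show "inj_on (r \<circ> f) (pverts H)"
      using f r(1) fT by (auto simp: induced_embedding_def inj_on_def)
    show "(r \<circ> f) ` pverts H \<subseteq> pverts (graph_on 4 consecutive)"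
      using r4 by auto
    fix p q assume "p \<in> pverts H" "q \<in> pverts H"
    then show "((r \<circ> f) p, (r \<circ> f) q) \<in> parcs (graph_on 4 consecutive) \<longleftrightarrow> (p, q) \<in> parcs H"
      using f r(3) fT f5 r4 by (simp add: induced_embedding_def)
  qed
  then show ?thesis by blast
qed

text \<open>If both graphs contained \<open>H\<close>, then \<open>H\<close> would embed into
  \<open>path4\<close>. So when both fail a rank property, one of them is a counterexample free of
  \<open>H\<close>.\<close>

lemma path5_or_graph_on_6_free:
  assumes H: "pair_graph H" and "\<not> contains_induced path4 H"
    and E: "symp E" "irreflp E" "\<And>u v. u \<noteq> v \<Longrightarrow> \<not> E u v \<Longrightarrow> hexagon u v"
  shows "graph_on 5 consecutive \<in> free_graphs H \<or> graph_on 6 E \<in> free_graphs H"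
proof -
  note graphs = pair_graph_graph_on[OF consecutive_sym consecutive_irrefl] pair_graph_graph_on[OF E(1,2)]
  have "\<not> (contains_induced (graph_on 5 consecutive) H \<and> contains_induced (graph_on 6 E) H)"
    using embeds_in_path4[of _ H _ E] E(3) assms(2)
    by (auto simp: contains_induced_iff pair_graph_imp_pair_wf_digraph graphs H path4_eq)
  then show ?thesis by (auto simp: free_graphs_def graphs)
qed

theorem theorem4p3:
  fixes H :: "'a pair_pre_digraph"
  assumes "pair_graph H"
  shows "((\<forall>G \<in> (free_graphs H :: nat pair_pre_digraph set).
             no_isolated_vertex G \<longrightarrow> duplication_rank_property G)
           \<longleftrightarrow> contains_induced path4 H) \<and>
         ((\<forall>G \<in> (free_graphs H :: nat pair_pre_digraph set). coduplication_rank_property G)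
           \<longleftrightarrow> contains_induced path4 H)"
proof -
  have path4: "pair_graph path4"
    unfolding path4_eq by (rule pair_graph_graph_on[OF consecutive_sym consecutive_irrefl])
  \<comment> \<open>Containment is transitive: a copy of \<open>path4\<close> in \<open>G\<close>
    would bring a copy of \<open>H\<close>.\<close>
  have free: "pair_graph G \<and> \<not> contains_induced G path4"
    if "contains_induced path4 H" "G \<in> free_graphs H" for G :: "nat pair_pre_digraph"
  proof -
    have G: "pair_graph G" using that by (simp add: free_graphs_def)
    then show ?thesis
      using that induced_embedding_comp[of _ H path4 _ G]
      by (auto simp: free_graphs_def contains_induced_iff pair_graph_imp_pair_wf_digraph assms path4)
  qed
  have co_sym: "symp (co hexagon)" "symp (co path5_plus_vertex)"
    by (auto simp: symp_def hexagon_def path5_plus_vertex_def consecutive_def)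
  have co_irrefl: "irreflp (co F)" for F :: "nat \<Rightarrow> nat \<Rightarrow> bool"
    by (simp add: irreflp_def)
  have "contains_induced path4 H"
    if "\<forall>G \<in> (free_graphs H :: nat pair_pre_digraph set). no_isolated_vertex G \<longrightarrow> duplication_rank_property G"
    using that path5_or_graph_on_6_free[OF assms _ co_sym(1) co_irrefl]
      path5_not_duplication_rank path5_no_isolated_vertex
      co_hexagon_not_duplication_rank co_hexagon_no_isolated_vertex
    by blast
  moreover have "contains_induced path4 H"
    if "\<forall>G \<in> (free_graphs H :: nat pair_pre_digraph set). coduplication_rank_property G"
    using that path5_or_graph_on_6_free[OF assms _ co_sym(2) co_irrefl]
      path5_not_coduplication_rank co_path5_plus_vertex_not_coduplication_rank
    by (auto simp: hexagon_def path5_plus_vertex_def)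
  ultimately show ?thesis
    using free rank_properties_if_no_path4 by blast
qed

end
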